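(* Let $m\ge 2$ and $n\ge 3$ be integers, and let $\mathcal{D}_m$, $\ell$ and $A(\mathcal{D}_m)$ be as defined in the context. Let $A(\mathcal{D}_m)^n$ denote the $n$-th $(\min,+)$ power of $A(\mathcal{D}_m)$. Then $$\min_{i} \big(A(\mathcal{D}_m)^n\big)_{ii} = \gamma_2(P_m\Box C_n),$$ where the minimum runs over all diagonal entries (i.e. over all vertices of $\mathcal{D}_m$).
   Context: $P_m$ is the path on $m$ vertices and $C_n$ the cycle on $n$ vertices. The Cartesian product $G\Box H$ has vertex set $V(G)\times V(H)$, with $(g_1,h_1)\sim(g_2,h_2)$ iff either $g_1=g_2$ and $h_1h_2\in E(H)$, or $g_1g_2\in E(G)$ and $h_1=h_2$. A $2$-dominating set of a graph $G$ is a set $S\subseteq V(G)$ such that every vertex not in $S$ has at least two neighbours in $S$; $\gamma_2(G)$ is the minimum cardinality of a $2$-dominating set. A correct $m$-word is a word $p=(p_1,\dots,p_m)$ over the alphabet $\{0,1,2\}$ that contains none of $020,111,211,112,212$ as a block of consecutive letters, whose first two letters $p_1p_2$ are neither $11$ nor $12$, and whose last two letters $p_{m-1}p_m$ are neither $11$ nor $21$. For correct $m$-words $q,p$, say that $p$ can follow $q$ if for every $i\in\{1,\dots,m\}$: (i) if $q_i=2$ then $p_i=0$; (ii) if $p_i=2$ then exactly one of $p_{i-1},p_{i+1},q_i$ equals $0$; (iii) if $p_i=1$ then at least two of $p_{i-1},p_{i+1},q_i$ equal $0$; here letters with index $0$ or $m+1$ are simply omitted from the lists in (ii) and (iii). The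 digraph $\mathcal{D}_m$ has as vertices all correct $m$-words, with an arc from $q$ to $p$ iff $p$ can follow $q$. The label of the arc $(q,p)$ is $\ell(q,p)=$ the number of letters $0$ in $p$. $A(\mathcal{D}_m)$ is the square matrix indexed by the vertices of $\mathcal{D}_m$ with $A(\mathcal{D}_m)_{qp}=\ell(q,p)$ if $(q,p)$ is an arc of $\mathcal{D}_m$ and $A(\mathcal{D}_m)_{qp}=\infty$ otherwise. Matrices are over the tropical semiring $(\mathbb{R}\cup\{\infty\},\min,+)$: the $(\min,+)$ product is $(A\boxtimes B)_{ij}=\min_k (a_{ik}+b_{kj})$, and $M^n$ is the $n$-fold $(\min,+)$ product of $M$ with itself. *)

theory Defs
  imports
    Complex_Main
    "HOL-Library.Extended_Real"
    "HOL-Library.Sublist"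
    "Graph_Theory.Pair_Digraph"
begin

text \<open>
  As in the Graph\_Theory entry, an undirected simple graph is a finite loopless digraph whose
  arc relation is symmetric (locale \<^locale>\<open>pair_graph\<close>): the edge \<open>uv\<close> is the pair of arcs
  \<open>(u, v)\<close>, \<open>(v, u)\<close>.
\<close>

definition path_graph :: "nat \<Rightarrow> nat pair_pre_digraph" where
  "path_graph m =
     \<lparr>pverts = {..<m}, parcs = {(u, v). u < m \<and> v < m \<and> (v = Suc u \<or> u = Suc v)}\<rparr>"

text \<open>This is the \<open>n\<close>-cycle for \<open>n \<ge> 3\<close> only.\<close>

definition cycle_graph :: "nat \<Rightarrow> nat pair_pre_digraph" where
  "cycle_graph n =
     \<lparr>pverts = {..<n},
      parcs = {(u, v). u < n \<and> v < n \<and> (v = Suc u mod n \<or> u = Suc v mod n)}\<rparr>"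

definition cartesian_product ::
    "'a pair_pre_digraph \<Rightarrow> 'b pair_pre_digraph \<Rightarrow> ('a \<times> 'b) pair_pre_digraph"
    (infixl "\<box>" 70) where
  "G \<box> H =
     \<lparr>pverts = pverts G \<times> pverts H,
      parcs = {((g1, h1), (g2, h2)).
        g1 \<in> pverts G \<and> g1 = g2 \<and> (h1, h2) \<in> parcs H \<or>
        (g1, g2) \<in> parcs G \<and> h1 \<in> pverts H \<and> h1 = h2}\<rparr>"

text \<open>Both \<^const>\<open>card\<close> and \<^const>\<open>Min\<close> confine these notions to finite graphs.\<close>

definition two_dominating :: "'a pair_pre_digraph \<Rightarrow> 'a set \<Rightarrow> bool" where
  "two_dominating G S \<longleftrightarrow>
     S \<subseteq> pverts G \<and> (\<forall>v \<in> pverts G - S. 2 \<le> card {u \<in> S. (v, u) \<in> parcs G})"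

definition two_domination_number :: "'a pair_pre_digraph \<Rightarrow> nat" (\<open>\<gamma>\<^sub>2\<close>) where
  "\<gamma>\<^sub>2 G = Min (card ` {S. two_dominating G S})"

text \<open>Words are lists, so the letter \<open>p\<^sub>i\<close> is \<open>p ! (i - 1)\<close>.\<close>

definition correct_word :: "nat \<Rightarrow> nat list \<Rightarrow> bool" where
  "correct_word m p \<longleftrightarrow>
     length p = m \<and> set p \<subseteq> {0, 1, 2} \<and>
     (\<forall>b \<in> {[0,2,0], [1,1,1], [2,1,1], [1,1,2], [2,1,2]}. \<not> sublist b p) \<and>
     (\<forall>b \<in> {[1,1], [1,2]}. \<not> prefix b p) \<and>
     (\<forall>b \<in> {[1,1], [2,1]}. \<not> suffix b p)"

text \<open>
  The letters \<open>p\<^sub>i\<^sub>-\<^sub>1\<close>, \<open>p\<^sub>i\<^sub>+\<^sub>1\<close>, \<open>q\<^sub>i\<close> (with \<open>i\<close> shifted to start from \<open>0\<close>), where nonexistent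
  letters are omitted.
\<close>

definition surrounding :: "nat list \<Rightarrow> nat list \<Rightarrow> nat \<Rightarrow> nat list" where
  "surrounding q p i =
     (if 0 < i then [p ! (i - 1)] else []) @
     (if Suc i < length p then [p ! Suc i] else []) @
     [q ! i]"

definition can_follow :: "nat list \<Rightarrow> nat list \<Rightarrow> bool" where
  "can_follow p q \<longleftrightarrow>
     (\<forall>i < length p.
        (q ! i = 2 \<longrightarrow> p ! i = 0) \<and>
        (p ! i = 2 \<longrightarrow> count_list (surrounding q p i) 0 = 1) \<and>
        (p ! i = 1 \<longrightarrow> 2 \<le> count_list (surrounding q p i) 0))"

definition word_digraph :: "nat \<Rightarrow> nat list pair_pre_digraph" (\<open>\<D>\<close>) where
  "\<D> m =
     \<lparr>pverts = {p. correct_word m p},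
      parcs = {(q, p). correct_word m q \<and> correct_word m p \<and> can_follow p q}\<rparr>"

fun arc_label :: "nat list \<times> nat list \<Rightarrow> nat" where
  "arc_label (q, p) = count_list p 0"

text \<open>
  Square matrices over the tropical semiring, with rows and columns indexed by a finite set \<open>V\<close>,
  are functions of two arguments restricted to \<open>V\<close>. The scalars are taken from \<^typ>\<open>ereal\<close>;
  the additional value \<open>-\<infinity>\<close> does not occur in the matrices below.
\<close>

type_synonym 'a trop_matrix = "'a \<Rightarrow> 'a \<Rightarrow> ereal"

definition trop_mult :: "'a set \<Rightarrow> 'a trop_matrix \<Rightarrow> 'a trop_matrix \<Rightarrow> 'a trop_matrix" where
  "trop_mult V A B = (\<lambda>i j. Min ((\<lambda>k. A i k + B k j) ` V))"

text \<open>The zeroth power is the tropical identity matrix.\<close>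

primrec trop_power :: "'a set \<Rightarrow> 'a trop_matrix \<Rightarrow> nat \<Rightarrow> 'a trop_matrix" where
  "trop_power V A 0 = (\<lambda>i j. if i = j then 0 else \<infinity>)"
| "trop_power V A (Suc n) = trop_mult V (trop_power V A n) A"

definition label_matrix :: "nat \<Rightarrow> nat list trop_matrix" where
  "label_matrix m =
     (\<lambda>q p. if (q, p) \<in> parcs (\<D> m) then ereal (real (arc_label (q, p))) else \<infinity>)"

text \<open>The definitions yield simple graphs, and the minima used range over nonempty finite sets.\<close>

lemma pair_graph_path_graph: "pair_graph (path_graph m)"
proof
  show "finite (parcs (path_graph m))"
    by (rule finite_subset[of _ "{..<m} \<times> {..<m}"]) (auto simp: path_graph_def)
qed (auto simp: path_graph_def symmetric_def sym_def)

lemma pair_graph_cycle_graph: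
  assumes "3 \<le> n"
  shows "pair_graph (cycle_graph n)"
proof
  show "finite (parcs (cycle_graph n))"
    by (rule finite_subset[of _ "{..<n} \<times> {..<n}"]) (auto simp: cycle_graph_def)
  have "u \<noteq> Suc u mod n" if "u < n" for u
    using that assms by (cases "Suc u = n") auto
  then show "fst e \<noteq> snd e" if "e \<in> parcs (cycle_graph n)" for e
    using that by (auto simp: cycle_graph_def) metis+
qed (auto simp: cycle_graph_def symmetric_def sym_def)

lemma pair_graph_cartesian_product:
  assumes "pair_graph G" "pair_graph H"
  shows "pair_graph (G \<box> H)"
proof -
  interpret G: pair_graph G by fact
  interpret H: pair_graph H by fact
  show ?thesis
  proof
    show "finite (pverts (G \<box> H))"
      by (simp add: cartesian_product_def G.pair_finite_verts H.pair_finite_verts)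
    show "finite (parcs (G \<box> H))"
      by (rule finite_subset[of _ "(pverts G \<times> pverts H) \<times> (pverts G \<times> pverts H)"])
        (auto simp: cartesian_product_def G.pair_finite_verts H.pair_finite_verts
          dest: G.wellformed' H.wellformed')
  qed (auto simp: cartesian_product_def symmetric_def sym_def
      dest: G.wellformed' H.wellformed' G.arcs_symmetric H.arcs_symmetric G.no_loops' H.no_loops')
qed

lemma finite_two_dominating: "finite (pverts G) \<Longrightarrow> finite {S. two_dominating G S}"
  by (rule finite_subset[of _ "Pow (pverts G)"]) (auto simp: two_dominating_def)

lemma two_dominating_pverts: "two_dominating G (pverts G)"
  by (simp add: two_dominating_def)

lemma finite_pverts_word_digraph: "finite (pverts (\<D> m))"
  by (rule finite_subset[OF _ finite_lists_length_eq[of "{0, 1, 2}" m]])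
    (auto simp: word_digraph_def correct_word_def)

lemma replicate_0_in_word_digraph: "replicate m 0 \<in> pverts (\<D> m)"
proof -
  have "\<not> sublist b (replicate m (0::nat)) \<and> \<not> prefix b (replicate m 0) \<and>
      \<not> suffix b (replicate m 0)" if "1 \<in> set b \<or> 2 \<in> set b" for b
    using that by (force dest: set_mono_sublist set_mono_prefix set_mono_suffix
        simp: set_replicate_conv_if split: if_splits)
  then show ?thesis
    by (auto simp: word_digraph_def correct_word_def set_replicate_conv_if)
qed

end

theory Submission
  imports Defs
begin

text \<open>
  The columns of \<open>P\<^sub>m \<box> C\<^sub>n\<close> are read as words: the letter \<open>0\<close> marks a vertex of the set \<open>S\<close>,
  the letter \<open>1\<close> a vertex outside \<open>S\<close> that has two neighbours in \<open>S\<close> without the help of the next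
  column, and \<open>2\<close> a vertex that needs the next column. Since every neighbour of a vertex lies in
  the column itself, the previous or the next one, closed walks of length \<open>n\<close> in \<open>\<D> m\<close> and
  \<open>2\<close>-dominating sets determine each other, and the sum of the labels is the cardinality of \<open>S\<close>.
\<close>

section \<open>Tropical powers and walks\<close>

lemma trop_power_le_walk:
  assumes "finite V" and "\<And>k. w k \<in> V"
  shows "trop_power V A n (w 0) (w n) \<le> (\<Sum>k<n. A (w k) (w (Suc k)))"
proof (induction n)
  case (Suc n)
  have "trop_power V A (Suc n) (w 0) (w (Suc n))
      \<le> trop_power V A n (w 0) (w n) + A (w n) (w (Suc n))"
    using assms by (auto simp: trop_mult_def intro!: Min_le)
  also have "\<dots> \<le> (\<Sum>k<n. A (w k) (w (Suc k))) + A (w n) (w (Suc n))"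
    by (intro add_right_mono Suc.IH)
  finally show ?case by simp
qed simp

text \<open>Each minimum over the finite set \<open>V\<close> is attained, so a walk can be
  recovered by peeling off the last arc, which is why the induction generalizes over
  \<open>j\<close>. A sum other than \<open>\<infinity>\<close> has no summand
  \<open>\<infinity>\<close>, so every step is an arc.\<close>

lemma trop_power_walk:
  assumes "finite V" and "i \<in> V" and "trop_power V A n i j \<noteq> \<infinity>" and "j \<in> V"
  obtains w where "w 0 = i" and "w n = j" and "\<And>k. k \<le> n \<Longrightarrow> w k \<in> V"
    and "\<And>k. k < n \<Longrightarrow> A (w k) (w (Suc k)) \<noteq> \<infinity>"
    and "trop_power V A n i j = (\<Sum>k<n. A (w k) (w (Suc k)))"
  using assms(3,4)
proof (induction n arbitrary: j thesis)
  case 0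
  then show ?case
    by (auto split: if_splits intro: "0.prems"(1)[of "\<lambda>_. i"] simp: assms(2))
next
  case (Suc n)
  have "Min ((\<lambda>k. trop_power V A n i k + A k j) ` V)
      \<in> (\<lambda>k. trop_power V A n i k + A k j) ` V"
    using assms by (intro Min_in) auto
  then obtain k where k: "k \<in> V"
    "trop_power V A (Suc n) i j = trop_power V A n i k + A k j"
    by (auto simp: trop_mult_def)
  with Suc.prems(2) have pow: "trop_power V A n i k \<noteq> \<infinity>" and fin: "A k j \<noteq> \<infinity>" by auto
  obtain w where w: "w 0 = i" "w n = k" "\<And>l. l \<le> n \<Longrightarrow> w l \<in> V"
    "\<And>l. l < n \<Longrightarrow> A (w l) (w (Suc l)) \<noteq> \<infinity>"
    "trop_power V A n i k = (\<Sum>l<n. A (w l) (w (Suc l)))"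
    by (rule Suc.IH[OF _ pow k(1)], rule that)
  show ?case
  proof (rule Suc.prems(1)[of "w(Suc n := j)"])
    have "(\<Sum>l<n. A ((w(Suc n := j)) l) ((w(Suc n := j)) (Suc l)))
        = (\<Sum>l<n. A (w l) (w (Suc l)))"
      by (rule sum.cong) auto
    then show "trop_power V A (Suc n) i j
        = (\<Sum>l<Suc n. A ((w(Suc n := j)) l) ((w(Suc n := j)) (Suc l)))"
      using k(2) w(2,5) by simp
  qed (use w fin Suc.prems(3) in \<open>auto simp: less_Suc_eq le_Suc_eq\<close>)
qed

section \<open>Columns of the product graph\<close>

definition zeros :: "nat \<Rightarrow> nat \<Rightarrow> (nat \<Rightarrow> nat list) \<Rightarrow> (nat \<times> nat) set" where
  "zeros m n W = {(a, b). a < m \<and> b < n \<and> W b ! a = 0}"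

lemma mem_zeros: "(a, b) \<in> zeros m n W \<longleftrightarrow> a < m \<and> b < n \<and> W b ! a = 0"
  by (simp add: zeros_def)

lemma pverts_path_cycle: "pverts (path_graph m \<box> cycle_graph n) = {..<m} \<times> {..<n}"
  by (simp add: cartesian_product_def path_graph_def cycle_graph_def)

text \<open>The inverse of \<open>Suc b mod n\<close> on \<open>{..<n}\<close>. The case
  \<open>b = 0\<close> is separate because natural subtraction truncates there.\<close>

definition cyc_pred :: "nat \<Rightarrow> nat \<Rightarrow> nat" where
  "cyc_pred n b = (if b = 0 then n - 1 else b - 1)"

lemma cyc_pred_less: "b < n \<Longrightarrow> cyc_pred n b < n"
  by (auto simp: cyc_pred_def)

lemma Suc_cyc_pred: "b < n \<Longrightarrow> Suc (cyc_pred n b) mod n = b"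
  by (auto simp: cyc_pred_def)

lemma eq_Suc_mod_iff: "b < n \<Longrightarrow> c < n \<Longrightarrow> b = Suc c mod n \<longleftrightarrow> c = cyc_pred n b"
  by (auto simp: cyc_pred_def mod_Suc)

lemma cyc_pred_Suc_mod: "b < n \<Longrightarrow> cyc_pred n (Suc b mod n) = b"
  by (metis eq_Suc_mod_iff mod_less_divisor not_less_zero not_gr_zero)

lemma bij_betw_Suc_mod: "bij_betw (\<lambda>b. Suc b mod n) {..<n} {..<n}"
  by (rule bij_betw_byWitness[where f' = "cyc_pred n"])
    (auto simp: cyc_pred_Suc_mod Suc_cyc_pred cyc_pred_less)

lemma card_zeros:
  assumes "\<And>b. b < n \<Longrightarrow> length (W b) = m"
  shows "card (zeros m n W) = (\<Sum>b<n. count_list (W b) 0)"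
proof -
  have "zeros m n W = prod.swap ` (SIGMA b:{..<n}. {a. a < m \<and> W b ! a = 0})"
    by (auto simp: zeros_def image_iff)
  then have "card (zeros m n W) = (\<Sum>b<n. card {a. a < m \<and> W b ! a = 0})"
    by (simp add: card_image)
  also have "\<dots> = (\<Sum>b<n. count_list (W b) 0)"
    using assms
    by (intro sum.cong)
      (auto simp: count_list_eq_length_filter length_filter_conv_card intro!: arg_cong[where f = card])
  finally show ?thesis .
qed

text \<open>An arc label counts the zeros of the target word; going once around the cycle, each
  column is the target exactly once.\<close>

lemma sum_count_list_Suc_mod:
  "(\<Sum>b<n. count_list (W (Suc b mod n)) 0) = (\<Sum>b<n. count_list (W b) (0::nat))"
  using sum.reindex_bij_betw[OF bij_betw_Suc_mod, of "\<lambda>b. count_list (W b) 0"] by simp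

text \<open>The link between words and graph: \<open>surrounding\<close> covers every neighbour
  except the one in the next column. With \<open>3 \<le> n\<close> the previous and next columns
  differ, so no neighbour is counted twice.\<close>

lemma card_neighbours_zeros:
  assumes "3 \<le> n" and "a < m" and "b < n" and "length (W b) = m"
  shows "card {u \<in> zeros m n W. ((a, b), u) \<in> parcs (path_graph m \<box> cycle_graph n)} =
    count_list (surrounding (W (cyc_pred n b)) (W b) a) 0 +
      (if W (Suc b mod n) ! a = 0 then 1 else 0)"
proof -
  \<comment> \<open>The neighbours of \<open>(a, b)\<close> in the order used by
    \<open>surrounding\<close>, followed by the one in the next column.\<close>
  define L where "L = (if 0 < a then [(a - 1, b)] else []) @
    (if Suc a < m then [(Suc a, b)] else []) @ [(a, cyc_pred n b), (a, Suc b mod n)]"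
  define f where "f = (\<lambda>(x, y). W y ! x)"
  have neq: "cyc_pred n b \<noteq> b" "Suc b mod n \<noteq> b" "cyc_pred n b \<noteq> Suc b mod n"
    using assms(1,3) by (auto simp: cyc_pred_def mod_Suc)
  have lt: "cyc_pred n b < n" "Suc b mod n < n"
    using assms(3) by (auto simp: cyc_pred_less)
  have "distinct L" using neq by (auto simp: L_def)
  have "u \<in> zeros m n W \<and> ((a, b), u) \<in> parcs (path_graph m \<box> cycle_graph n)
      \<longleftrightarrow> u \<in> set (filter (\<lambda>u. f u = 0) L)" for u
  proof (cases u)
    case (Pair x y)
    have "((a, b), u) \<in> parcs (path_graph m \<box> cycle_graph n) \<longleftrightarrow>
        x < m \<and> y < n \<and> (a = x \<and> (y = Suc b mod n \<or> y = cyc_pred n b) \<or>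
          b = y \<and> (x = Suc a \<or> a = Suc x))"
      using assms(2,3) eq_Suc_mod_iff[of b n y]
      by (auto simp: Pair cartesian_product_def path_graph_def cycle_graph_def)
    then show ?thesis
      using assms(2,3) lt by (auto simp: Pair zeros_def L_def f_def)
  qed
  then have "{u \<in> zeros m n W. ((a, b), u) \<in> parcs (path_graph m \<box> cycle_graph n)}
      = set (filter (\<lambda>u. f u = 0) L)"
    by blast
  then have "card {u \<in> zeros m n W. ((a, b), u) \<in> parcs (path_graph m \<box> cycle_graph n)}
      = length (filter (\<lambda>u. f u = 0) L)"
    using \<open>distinct L\<close> by (metis distinct_card distinct_filter)
  also have "\<dots> = count_list (surrounding (W (cyc_pred n b)) (W b) a) 0 +
      (if W (Suc b mod n) ! a = 0 then 1 else 0)"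
    by (auto simp: L_def f_def surrounding_def assms(4))
  finally show ?thesis .
qed

section \<open>Closed walks and 2-dominating sets\<close>

text \<open>A letter 1 has two zeros around it by the arc into its column. A letter 2 has one by
  that arc, and the arc out of its column forces a second.\<close>

lemma two_dominating_zeros:
  assumes "3 \<le> n"
    and arcs: "\<And>b. b < n \<Longrightarrow> (W b, W (Suc b mod n)) \<in> parcs (\<D> m)"
  shows "two_dominating (path_graph m \<box> cycle_graph n) (zeros m n W)"
proof -
  have "2 \<le> card {u \<in> zeros m n W. ((a, b), u) \<in> parcs (path_graph m \<box> cycle_graph n)}"
    if "a < m" "b < n" "W b ! a \<noteq> 0" for a b
  proof -
    have "correct_word m (W b)" and next0: "W b ! a = 2 \<longrightarrow> W (Suc b mod n) ! a = 0"
      using arcs[OF that(2)] that(1) by (auto simp: word_digraph_def can_follow_def correct_word_def)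
    then have len: "length (W b) = m" and "W b ! a \<in> {0, 1, 2}"
      using that(1) by (auto simp: correct_word_def dest!: subsetD[OF _ nth_mem])
    moreover have "can_follow (W b) (W (cyc_pred n b))"
      using arcs[OF cyc_pred_less[OF that(2)]] Suc_cyc_pred[OF that(2)]
      by (simp add: word_digraph_def)
    ultimately show ?thesis
      using that next0 unfolding card_neighbours_zeros[of n a m b W, OF assms(1) that(1,2) len]
      by (auto simp: can_follow_def)
  qed
  then show ?thesis
    by (auto simp: two_dominating_def pverts_path_cycle mem_zeros)
qed

text \<open>The letters are read off from \<open>S\<close> alone, with no reference to other
  letters. The neighbour in the next column is left out, as a letter 1 must not rely on it.\<close>

definition column :: "nat \<Rightarrow> nat \<Rightarrow> (nat \<times> nat) set \<Rightarrow> nat \<Rightarrow> nat list" where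
  "column m n S b = map (\<lambda>a. if (a, b) \<in> S then 0
     else if 2 \<le> card {u \<in> S. ((a, b), u) \<in> parcs (path_graph m \<box> cycle_graph n) \<and>
       u \<noteq> (a, Suc b mod n)} then 1 else 2) [0..<m]"

lemma length_column [simp]: "length (column m n S b) = m"
  by (simp add: column_def)

lemma column_eq_0_iff: "a < m \<Longrightarrow> column m n S b ! a = 0 \<longleftrightarrow> (a, b) \<in> S"
  by (simp add: column_def)

lemma zeros_column:
  assumes "S \<subseteq> pverts (path_graph m \<box> cycle_graph n)"
  shows "zeros m n (column m n S) = S"
  using assms
  by (auto simp: zeros_def column_eq_0_iff pverts_path_cycle)

text \<open>The previous column supplies at most one zero, so a letter 1 needs another zero above or
  below it, and at an end of the word only one such place exists. A letter 2 between two zeros would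
  see at least two.\<close>

lemma correct_word_if_can_follow:
  assumes "length p = m" and "set p \<subseteq> {0, 1, 2}" and follow: "can_follow p q"
  shows "correct_word m p"
proof -
  have one: "2 \<le> count_list (surrounding q p i) 0" if "i < length p" "p ! i = 1" for i
    using follow that by (auto simp: can_follow_def)
  have two: "count_list (surrounding q p i) 0 = 1" if "i < length p" "p ! i = 2" for i
    using follow that by (auto simp: can_follow_def)
  have inner: "y = 1 \<Longrightarrow> x = 0 \<or> z = 0" "y = 2 \<Longrightarrow> x \<noteq> 0 \<or> z \<noteq> 0"
    if "sublist [x, y, z] p" for x y z
  proof -
    from that obtain us vs where p: "p = us @ [x, y, z] @ vs" by (auto simp: sublist_def)
    show "y = 1 \<Longrightarrow> x = 0 \<or> z = 0" "y = 2 \<Longrightarrow> x \<noteq> 0 \<or> z \<noteq> 0"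
      using one[of "Suc (length us)"] two[of "Suc (length us)"]
      by (auto simp: p surrounding_def nth_append split: if_splits)
  qed
  have first: "y = 0" if "prefix [Suc 0, y] p" for y
    using that one[of 0] by (auto simp: prefix_def surrounding_def split: if_splits)
  have last: "y = 0" if "suffix [y, Suc 0] p" for y
  proof -
    from that obtain us where p: "p = us @ [y, 1]" by (auto simp: suffix_def)
    show ?thesis
      using one[of "Suc (length us)"]
      by (auto simp: p surrounding_def nth_append split: if_splits)
  qed
  show ?thesis
    using assms(1,2) by (auto simp: correct_word_def dest: inner first last)
qed

lemma column_arc:
  assumes "3 \<le> n" and dom: "two_dominating (path_graph m \<box> cycle_graph n) S" and "b < n"
  shows "(column m n S b, column m n S (Suc b mod n)) \<in> parcs (\<D> m)"
proof -
  let ?G = "path_graph m \<box> cycle_graph n" and ?C = "column m n S"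
  have S: "S \<subseteq> pverts ?G" using dom by (simp add: two_dominating_def)
  have "finite (pverts ?G)" by (simp add: pverts_path_cycle)
  with S have fin: "finite S" by (rule finite_subset)
  have set: "set (?C b) \<subseteq> {0, 1, 2}" for b by (auto simp: column_def)
  have letters: "(?C b ! a = 1 \<longrightarrow> 2 \<le> count_list (surrounding (?C (cyc_pred n b)) (?C b) a) 0) \<and>
      (?C b ! a = 2 \<longrightarrow> count_list (surrounding (?C (cyc_pred n b)) (?C b) a) 0 = 1 \<and>
        ?C (Suc b mod n) ! a = 0)" (is "(_ \<longrightarrow> 2 \<le> ?k) \<and> _")
    if "a < m" "b < n" for a b
  proof -
    let ?N = "{u \<in> S. ((a, b), u) \<in> parcs ?G}" and ?x = "(a, Suc b mod n)"
    have card: "card ?N = ?k + (if ?x \<in> S then 1 else 0)"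
      using card_neighbours_zeros[of n a m b ?C, OF assms(1) that length_column] that
      by (simp add: zeros_column[OF S] column_eq_0_iff)
    have "{u \<in> S. ((a, b), u) \<in> parcs ?G \<and> u \<noteq> ?x} = ?N - {?x}" by auto
    moreover have "((a, b), ?x) \<in> parcs ?G"
      using that by (auto simp: cartesian_product_def path_graph_def cycle_graph_def)
    \<comment> \<open>Thus the test in \<open>column\<close> that separates 1 from 2 is
      \<open>2 \<le> ?k\<close>. When it fails, domination leaves only \<open>?k = 1\<close> with
      \<open>?x\<close> in \<open>S\<close>, as a letter 2 demands.\<close>
    ultimately have k: "card {u \<in> S. ((a, b), u) \<in> parcs ?G \<and> u \<noteq> ?x} = ?k"
      using card fin by (simp add: card_Diff_singleton_if)
    have "2 \<le> card ?N" if "(a, b) \<notin> S"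
      using dom that \<open>a < m\<close> \<open>b < n\<close>
      by (auto simp: two_dominating_def pverts_path_cycle)
    moreover have "?C b ! a = (if (a, b) \<in> S then 0 else if 2 \<le> ?k then 1 else 2)"
      using that unfolding k[symmetric] by (simp add: column_def)
    ultimately show ?thesis
      using card that by (auto simp: column_eq_0_iff split: if_splits)
  qed
  \<comment> \<open>Needed for all columns: both words of the arc owe their correctness to their own
    predecessors.\<close>
  have follow: "can_follow (?C b) (?C (cyc_pred n b))" if "b < n" for b
    using letters[OF _ that] letters[OF _ cyc_pred_less[OF that]] Suc_cyc_pred[OF that]
    by (auto simp: can_follow_def)
  have "can_follow (?C (Suc b mod n)) (?C b)"
    using follow[of "Suc b mod n"] cyc_pred_Suc_mod[OF assms(3)] assms(3) by simp
  then show ?thesis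
    using correct_word_if_can_follow[OF length_column set follow[OF assms(3)]]
      correct_word_if_can_follow[OF length_column set]
    by (auto simp: word_digraph_def)
qed

theorem theorem2:
  fixes m n :: nat
  assumes "2 \<le> m" and "3 \<le> n"
  shows "Min ((\<lambda>i. trop_power (pverts (\<D> m)) (label_matrix m) n i i) ` pverts (\<D> m)) =
    ereal (real (\<gamma>\<^sub>2 (path_graph m \<box> cycle_graph n)))"
proof (rule Min_eqI)
  let ?G = "path_graph m \<box> cycle_graph n" and ?V = "pverts (\<D> m)" and ?A = "label_matrix m"
  have "finite (pverts ?G)" by (simp add: pverts_path_cycle)
  note fin = finite_two_dominating[OF this]
  have arc_tail: "q \<in> ?V" if "(q, p) \<in> parcs (\<D> m)" for q p
    using that by (auto simp: word_digraph_def)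
  have weight: "(\<Sum>b<n. ?A (W b) (W (Suc b mod n))) = ereal (real (card (zeros m n W)))"
    if arcs: "\<And>b. b < n \<Longrightarrow> (W b, W (Suc b mod n)) \<in> parcs (\<D> m)" for W
  proof -
    have "length (W b) = m" if "b < n" for b
      using arcs[OF that] by (simp add: word_digraph_def correct_word_def)
    then have "card (zeros m n W) = (\<Sum>b<n. count_list (W (Suc b mod n)) 0)"
      by (simp add: card_zeros sum_count_list_Suc_mod)
    then show ?thesis
      using arcs by (simp add: label_matrix_def)
  qed
  have lower: "ereal (real (\<gamma>\<^sub>2 ?G)) \<le> trop_power ?V ?A n i i" if i: "i \<in> ?V" for i
  proof (cases "trop_power ?V ?A n i i = \<infinity>")
    case False
    obtain w where w: "w 0 = i" "w n = i" "\<And>k. k \<le> n \<Longrightarrow> w k \<in> ?V"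
      "\<And>k. k < n \<Longrightarrow> ?A (w k) (w (Suc k)) \<noteq> \<infinity>"
      "trop_power ?V ?A n i i = (\<Sum>k<n. ?A (w k) (w (Suc k)))"
      by (rule trop_power_walk[OF finite_pverts_word_digraph i False i], rule that)
    \<comment> \<open>The index wraps only at \<open>Suc b = n\<close>, where \<open>w 0\<close> and
      \<open>w n\<close> are both \<open>i\<close>.\<close>
    have closed: "w (Suc b mod n) = w (Suc b)" if "b < n" for b
      using that w(1,2) by (auto simp: mod_Suc)
    have arcs: "(w b, w (Suc b mod n)) \<in> parcs (\<D> m)" if "b < n" for b
      using w(4)[OF that] closed[OF that] by (auto simp: label_matrix_def split: if_splits)
    have "\<gamma>\<^sub>2 ?G \<le> card (zeros m n w)"
      using two_dominating_zeros[where W = w, OF assms(2) arcs] fin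
      by (auto simp: two_domination_number_def intro!: Min_le)
    moreover have "trop_power ?V ?A n i i = ereal (real (card (zeros m n w)))"
      using weight[where W = w, OF arcs] w(5) by (simp add: closed)
    ultimately show ?thesis by simp
  qed simp
  then show "ereal (real (\<gamma>\<^sub>2 ?G)) \<le> x"
    if "x \<in> (\<lambda>i. trop_power ?V ?A n i i) ` ?V" for x
    using that by auto
  have "\<gamma>\<^sub>2 ?G \<in> card ` {S. two_dominating ?G S}"
    using fin two_dominating_pverts unfolding two_domination_number_def by (intro Min_in) auto
  then obtain S where S: "two_dominating ?G S" "card S = \<gamma>\<^sub>2 ?G" by auto
  define C where "C = column m n S"
  have arcs: "(C b, C (Suc b mod n)) \<in> parcs (\<D> m)" if "b < n" for b
    using column_arc[OF assms(2) S(1) that] by (simp add: C_def)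
  \<comment> \<open>The periodic extension stays in \<open>?V\<close> at every index and closes up,
    since \<open>w n = w 0\<close>.\<close>
  define w where "w = (\<lambda>k. C (k mod n))"
  have V: "w k \<in> ?V" for k
    using arc_tail[OF arcs[of "k mod n"]] assms(2) by (simp add: w_def)
  have "trop_power ?V ?A n (w 0) (w n) \<le> (\<Sum>k<n. ?A (w k) (w (Suc k)))"
    by (rule trop_power_le_walk[where w = w, OF finite_pverts_word_digraph V])
  also have "\<dots> = (\<Sum>k<n. ?A (C k) (C (Suc k mod n)))"
    by (simp add: w_def)
  also have "\<dots> = ereal (real (\<gamma>\<^sub>2 ?G))"
    using weight[where W = C, OF arcs] S by (simp add: C_def zeros_column two_dominating_def)
  \<comment> \<open>The walk of a minimum set bounds this diagonal entry from above, and
    \<open>lower\<close> bounds it from below, so the minimum is attained here.\<close>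
  finally have "trop_power ?V ?A n (w 0) (w 0) = ereal (real (\<gamma>\<^sub>2 ?G))"
    using lower[OF V[of 0]] by (simp add: w_def)
  then show "ereal (real (\<gamma>\<^sub>2 ?G)) \<in> (\<lambda>i. trop_power ?V ?A n i i) ` ?V"
    by (intro image_eqI[OF _ V[of 0]]) simp
qed (simp add: finite_pverts_word_digraph)

end
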